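(* Let $\varepsilon\in(0,1)$ and $\alpha\in[0,\infty]$. Let $D_\alpha^{\mathbb M}$ be the measured (minimal) quantum extension of the classical Rényi divergence $D_\alpha$, and let $D_H^\varepsilon$ be the hypothesis testing divergence. Define $$\nu_H(\varepsilon,\alpha):=\sup_A\sup_{\rho,\sigma\in\mathfrak D(A)}\Big\{D_\alpha^{\mathbb M}(\rho\|\sigma)-D_H^\varepsilon(\rho\|\sigma)\Big\},$$ where the supremum is over all finite-dimensional systems $A$; i.e. $\nu_H(\varepsilon,\alpha)$ is the smallest number such that $D_H^\varepsilon(\rho\|\sigma)\ge D_\alpha^{\mathbb M}(\rho\|\sigma)-\nu_H(\varepsilon,\alpha)$ for all finite-dimensional $A$ and all $\rho,\sigma\in\mathfrak D(A)$ (and $\nu_H=\infty$ if there is no such finite number). Then $$\nu_H(\varepsilon,\alpha)=\begin{cases}-\log\frac1{1-\varepsilon}&\text{if }\alpha\in[0,\varepsilon],\\[2pt] \frac{\alpha}{1-\alpha}\log\left(\frac{\alpha}{\varepsilon}\right)-\log\frac1{1-\alpha}&\text{if }\alpha\in(\varepsilon,1),\\[2pt] \infty&\text{if }\alpha\in[1,\infty].\end{cases}$$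
   Context: $\log$ is base 2. Classical Rényi divergence of probability vectors: for $\alpha\in(0,1)\cup(1,\infty)$, $D_\alpha(\mathbf p\|\mathbf q)=\frac1{\alpha-1}\log\sum_x p_x^\alpha q_x^{1-\alpha}$, equal to $\infty$ if $\alpha>1$ and $\mathrm{supp}(\mathbf p)\not\subseteq\mathrm{supp}(\mathbf q)$, or if $\alpha<1$ and the supports are disjoint; by continuity $D_0(\mathbf p\|\mathbf q)=-\log\sum_{x:p_x>0}q_x$, $D_1$ is the Kullback–Leibler divergence, and $D_\infty(\mathbf p\|\mathbf q)=\log\max_{x:p_x>0}p_x/q_x$. $\mathfrak{D}(A)$ is the set of density operators on a finite-dimensional Hilbert space $A$. The measured extension is $D_\alpha^{\mathbb M}(\rho\|\sigma)=\sup_{\mathcal E}D_\alpha(\mathcal E(\rho)\|\mathcal E(\sigma))$, the supremum running over all POVM measurement channels $\mathcal E$ from $A$ to a finite classical system $X$ (outputs regarded as probability vectors). Hypothesis testing divergence: $D_H^\varepsilon(\rho\|\sigma)=-\log\min\{\mathrm{Tr}[\Lambda\sigma]:\mathrm{Tr}[\Lambda\rho]\ge1-\varepsilon,\ 0\le\Lambda\le I_A\}$ (with $-\log 0=\infty$). *)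

theory Defs
  imports Complex_Main "HOL-Library.Extended_Real" "Jordan_Normal_Form.Matrix"
begin

definition neg_log2 :: "real \<Rightarrow> ereal" where
  "neg_log2 x = (if x \<le> 0 then \<infinity> else ereal (- log 2 x))"


section \<open>Classical Renyi divergence\<close>

definition supp :: "'x set \<Rightarrow> ('x \<Rightarrow> real) \<Rightarrow> 'x set" where
  "supp X p = {x \<in> X. p x > 0}"

text \<open>
  The division and \<open>powr\<close> are only relevant where their value is the mathematical one: when
  \<open>q x = 0\<close> contributes in the sum of the last branch, the convention \<open>0 powr b = 0\<close> yields the
  summand \<open>0\<close>, as intended (for \<open>a < 1\<close> because \<open>1 - a > 0\<close>, for \<open>a > 1\<close> because then
  \<open>p x = 0\<close>).
\<close>

definition renyi_div ::
    "ereal \<Rightarrow> 'x set \<Rightarrow> ('x \<Rightarrow> real) \<Rightarrow> ('x \<Rightarrow> real) \<Rightarrow> ereal" where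
  "renyi_div \<alpha> X p q =
    (if \<alpha> = 0 then neg_log2 (\<Sum>x\<in>supp X p. q x)
     else if \<alpha> = 1 then
       (if supp X p \<subseteq> supp X q
        then ereal (\<Sum>x\<in>supp X p. p x * log 2 (p x / q x)) else \<infinity>)
     else if \<alpha> = \<infinity> then
       (if supp X p \<subseteq> supp X q
        then ereal (log 2 (MAX x\<in>supp X p. p x / q x)) else \<infinity>)
     else (let a = real_of_ereal \<alpha> in
       if (a > 1 \<and> \<not> supp X p \<subseteq> supp X q) \<or> (a < 1 \<and> supp X p \<inter> supp X q = {})
       then \<infinity>
       else ereal (1 / (a - 1) * log 2 (\<Sum>x\<in>X. p x powr a * q x powr (1 - a)))))"


section \<open>States, measurements and effects\<close>

text \<open>A finite-dimensional Hilbert space of dimension \<open>n\<close> is \<open>\<complex>\<^sup>n\<close>; operators are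
  \<open>n \<times> n\<close> complex matrices.\<close>

definition mat_trace :: "complex mat \<Rightarrow> complex" where
  "mat_trace M = (\<Sum>i<dim_row M. M $$ (i, i))"

text \<open>The order on \<^typ>\<open>complex\<close> makes \<open>0 \<le> z\<close> say that \<open>z\<close> is real and nonnegative, so that
  self-adjointness is part of the condition.\<close>

definition psd :: "nat \<Rightarrow> complex mat \<Rightarrow> bool" where
  "psd n M \<longleftrightarrow>
    M \<in> carrier_mat n n \<and> (\<forall>v\<in>carrier_vec n. 0 \<le> (M *\<^sub>v v) \<bullet>c v)"

definition density :: "nat \<Rightarrow> complex mat set" where
  "density n = {\<rho>. psd n \<rho> \<and> mat_trace \<rho> = 1}"

text \<open>A POVM with outcome set \<open>{..<m}\<close>; completeness is the matrix identity
  \<open>\<Sum>x<m. E x = 1\<close>, written out entrywise.\<close>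

definition povm :: "nat \<Rightarrow> nat \<Rightarrow> (nat \<Rightarrow> complex mat) \<Rightarrow> bool" where
  "povm n m E \<longleftrightarrow>
    (\<forall>x<m. psd n (E x)) \<and> mat n n (\<lambda>ij. \<Sum>x<m. E x $$ ij) = 1\<^sub>m n"

definition measure_out :: "(nat \<Rightarrow> complex mat) \<Rightarrow> complex mat \<Rightarrow> nat \<Rightarrow> real" where
  "measure_out E \<rho> x = Re (mat_trace (E x * \<rho>))"

definition effect :: "nat \<Rightarrow> complex mat \<Rightarrow> bool" where
  "effect n \<Lambda> \<longleftrightarrow> psd n \<Lambda> \<and> psd n (1\<^sub>m n - \<Lambda>)"


section \<open>Quantum divergences\<close>

definition measured_renyi :: "ereal \<Rightarrow> nat \<Rightarrow> complex mat \<Rightarrow> complex mat \<Rightarrow> ereal" where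
  "measured_renyi \<alpha> n \<rho> \<sigma> =
    Sup {renyi_div \<alpha> {..<m} (measure_out E \<rho>) (measure_out E \<sigma>) | m E. povm n m E}"

text \<open>For states the infimum is attained, the set of feasible \<open>\<Lambda>\<close> being compact and
  nonempty.\<close>

definition hyp_test_div :: "real \<Rightarrow> nat \<Rightarrow> complex mat \<Rightarrow> complex mat \<Rightarrow> ereal" where
  "hyp_test_div \<epsilon> n \<rho> \<sigma> =
    neg_log2 (Inf {Re (mat_trace (\<Lambda> * \<sigma>)) | \<Lambda>.
      effect n \<Lambda> \<and> Re (mat_trace (\<Lambda> * \<rho>)) \<ge> 1 - \<epsilon>})"

text \<open>Difference of divergences. If the subtrahend is infinite, then \<open>b \<ge> a - \<nu>\<close> imposes no
  condition on \<open>\<nu>\<close>; accordingly \<open>\<infinity> - \<infinity>\<close> is read as \<open>-\<infinity>\<close> here, whereas it is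
  \<open>\<infinity>\<close> in \<^typ>\<open>ereal\<close>. Lemma \<open>nu_H_smallest\<close> below confirms this reading.\<close>

definition gap :: "ereal \<Rightarrow> ereal \<Rightarrow> ereal" where
  "gap a b = (if b = \<infinity> then -\<infinity> else a - b)"

definition nu_H :: "real \<Rightarrow> ereal \<Rightarrow> ereal" where
  "nu_H \<epsilon> \<alpha> =
    (SUP n. SUP (\<rho>, \<sigma>) \<in> density n \<times> density n.
      gap (measured_renyi \<alpha> n \<rho> \<sigma>) (hyp_test_div \<epsilon> n \<rho> \<sigma>))"

lemma gap_le_iff:
  "b \<noteq> -\<infinity> \<Longrightarrow> gap a b \<le> ereal \<nu> \<longleftrightarrow> b \<ge> a - ereal \<nu>"
  unfolding gap_def by (cases a; cases b) auto

lemma nu_H_le_iff: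
  "nu_H \<epsilon> \<alpha> \<le> ereal \<nu> \<longleftrightarrow>
    (\<forall>n. \<forall>\<rho>\<in>density n. \<forall>\<sigma>\<in>density n.
      hyp_test_div \<epsilon> n \<rho> \<sigma> \<ge> measured_renyi \<alpha> n \<rho> \<sigma> - ereal \<nu>)"
proof -
  have "hyp_test_div \<epsilon> n \<rho> \<sigma> \<noteq> -\<infinity>" for n \<rho> \<sigma>
    by (simp add: hyp_test_div_def neg_log2_def)
  then show ?thesis
    by (auto simp: nu_H_def SUP_le_iff gap_le_iff)
qed

lemma nu_H_smallest:
  "nu_H \<epsilon> \<alpha> = Inf {ereal \<nu> | \<nu>.
    \<forall>n. \<forall>\<rho>\<in>density n. \<forall>\<sigma>\<in>density n.
      hyp_test_div \<epsilon> n \<rho> \<sigma> \<ge> measured_renyi \<alpha> n \<rho> \<sigma> - ereal \<nu>}"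
proof -
  have "x = Inf {ereal \<nu> | \<nu>. x \<le> ereal \<nu>}" for x :: ereal
  proof (rule antisym)
    show "x \<le> Inf {ereal \<nu> | \<nu>. x \<le> ereal \<nu>}"
      by (auto intro: Inf_greatest)
    show "Inf {ereal \<nu> | \<nu>. x \<le> ereal \<nu>} \<le> x"
    proof (rule dense_ge)
      fix y assume "x < y"
      then obtain \<nu> where "x < ereal \<nu>" "ereal \<nu> < y"
        using ereal_dense2 by blast
      then show "Inf {ereal \<nu> | \<nu>. x \<le> ereal \<nu>} \<le> y"
        by (intro Inf_lower2[of "ereal \<nu>"]) auto
    qed
  qed
  from this[of "nu_H \<epsilon> \<alpha>"] show ?thesis
    unfolding nu_H_le_iff .
qed

end

theory Submission
  imports Defs "HOL-Analysis.Convex"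
begin

text \<open>
  Every classical test on the outcomes of a POVM lifts to an effect, so for the upper bound it
  suffices to test probability vectors \<open>p\<close>, \<open>q\<close>. A Neyman--Pearson test with threshold \<open>\<mu>\<close> and
  errors \<open>\<epsilon>\<close>, \<open>\<beta>\<close> satisfies
  \<open>\<epsilon> + \<mu> \<beta> = \<Sum>x. min (p x) (\<mu> q x) \<le> \<mu>\<^sup>1\<^sup>-\<^sup>a \<Sum>x. (p x)\<^sup>a (q x)\<^sup>1\<^sup>-\<^sup>a\<close>,
  and weighted AM-GM on the left-hand side eliminates \<open>\<mu>\<close>. For \<open>0 < a < \<epsilon>\<close> one uses the bound
  for the order \<open>\<epsilon>\<close> and monotonicity of the divergence in its order; for \<open>a = 0\<close> the test that is
  \<open>1 - \<epsilon>\<close> on the support of \<open>p\<close> suffices. With \<open>b = max a \<epsilon>\<close>, equality holds for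
  \<open>p = (\<epsilon>/b, 1 - \<epsilon>/b)\<close> and \<open>q = (1, 0)\<close>; for \<open>a \<ge> 1\<close> the pair
  \<open>p = (s, 1 - s)\<close>, \<open>q = (1, 0)\<close> with \<open>\<epsilon> < s < 1\<close> has infinite divergence and a finite
  hypothesis testing divergence.
\<close>

section \<open>Positive semidefinite forms\<close>

text \<open>The hypothesis is positivity of a Hermitian form along a line \<open>u + z e\<close>:
  \<open>c\<close> is its value at \<open>u\<close>, \<open>d\<close> its value at \<open>e\<close>,
  and \<open>L\<close>, \<open>R\<close> are the cross terms. The last conclusion is nonnegativity
  of the Schur complement.\<close>

lemma quadratic_form_nonneg:
  fixes c d L R :: complex
  assumes q: "\<And>z. 0 \<le> c + z * R + cnj z * L + z * cnj z * d"
  shows "0 \<le> d" "R = cnj L" "d = 0 \<Longrightarrow> L = 0" "0 \<le> c - R * L / d"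
proof -
  note * = q[unfolded less_eq_complex_def]
  have c: "Re c \<ge> 0" "Im c = 0" using *[of 0] by auto
  \<comment> \<open>Real and purely imaginary \<open>z\<close> are tried separately; comparing
    \<open>t = 1\<close> with \<open>t = -1\<close> then separates linear from quadratic
    coefficients.\<close>
  have p: "0 \<le> Re c + t * (Re R + Re L) + t * t * Re d" and p2: "0 = t * (Im R + Im L) + t * t * Im d" for t
    using *[of "complex_of_real t"] c by (auto simp: algebra_simps)
  have i2: "0 = t * (Re R - Re L) + t * t * Im d" for t
    using *[of "\<i> * complex_of_real t"] c by (auto simp: algebra_simps)
  have "Im d = 0" "Im R = - Im L" using p2[of 1] p2[of "-1"] by auto
  moreover have "Re R = Re L" using i2[of 1] i2[of "-1"] by auto
  ultimately show R: "R = cnj L" by (simp add: complex_eq_iff)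
  have quad: "0 \<le> Re c + 2 * Re (z * cnj L) + (cmod z)\<^sup>2 * Re d" for z
    using *[of z] unfolding R power2_eq_square cmod_power2[unfolded power2_eq_square] by (simp add: algebra_simps)
  \<comment> \<open>Along \<open>z = t L\<close> the cross terms become real, which leaves a real
    quadratic in \<open>t\<close>.\<close>
  have line: "0 \<le> Re c + 2 * t * (cmod L)\<^sup>2 + t\<^sup>2 * (cmod L)\<^sup>2 * Re d" for t
  proof -
    have "Re (complex_of_real t * L * cnj L) = t * (cmod L)\<^sup>2"
      by (simp add: mult.assoc complex_norm_square[symmetric] flip: of_real_power)
    then show ?thesis using quad[of "complex_of_real t * L"] by (simp add: norm_mult power_mult_distrib)
  qed
  show d: "0 \<le> d"
  proof (rule ccontr)
    assume "\<not> 0 \<le> d"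
    then have neg: "Re d < 0" using \<open>Im d = 0\<close> by (simp add: less_eq_complex_def)
    \<comment> \<open>The linear terms at \<open>s\<close> and \<open>-s\<close> cancel, and the two
      bounds add up to \<open>0 \<le> -2\<close>.\<close>
    define s where "s = sqrt ((Re c + 1) / (- Re d))"
    have s: "s\<^sup>2 * Re d = - (Re c + 1)"
      unfolding s_def using neg c by (simp add: field_simps)
    show False using p[of s] p[of "-s"] s by (simp add: power2_eq_square)
  qed
  show L: "L = 0" if "d = 0"
  proof (rule ccontr)
    assume "L \<noteq> 0"
    then have "(cmod L)\<^sup>2 > 0" by simp
    moreover from this have "0 \<le> Re c + 2 * (- (Re c + 1))"
      using line[of "- (Re c + 1) / (cmod L)\<^sup>2"] that by simp
    ultimately show False using c by simp
  qed
  show "0 \<le> c - R * L / d"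
  proof (cases "d = 0")
    case True then show ?thesis using L c by (simp add: less_eq_complex_def)
  next
    case False
    then have dp: "Re d > 0" and dr: "d = complex_of_real (Re d)" using d \<open>Im d = 0\<close>
      by (auto simp: less_eq_complex_def complex_eq_iff)
    have "R * L / d = complex_of_real ((cmod L)\<^sup>2 / Re d)"
      unfolding R by (metis dr complex_norm_square mult.commute of_real_divide)
    \<comment> \<open>The point \<open>- 1 / Re d\<close> minimises the quadratic.\<close>
    moreover have "(cmod L)\<^sup>2 / Re d \<le> Re c"
      using line[of "- 1 / Re d"] dp by (simp add: field_simps power2_eq_square)
    ultimately show ?thesis using c by (simp add: less_eq_complex_def)
  qed
qed

lemma complex_divide_nonneg:
  fixes d :: complex
  assumes "0 \<le> d" "0 \<le> z"
  shows "0 \<le> z / d"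
proof -
  have "d = complex_of_real (Re d)" "z = complex_of_real (Re z)" "Re d \<ge> 0" "Re z \<ge> 0"
    using assms by (auto simp: less_eq_complex_def complex_eq_iff)
  then show ?thesis by (metis divide_nonneg_nonneg less_eq_complex_def of_real_divide Re_complex_of_real Im_complex_of_real zero_complex.simps)
qed

text \<open>Kernels on an arbitrary index set take the place of matrices, so that an induction can
  remove one index without renumbering.\<close>

definition herm_form :: "'i set \<Rightarrow> ('i \<Rightarrow> 'i \<Rightarrow> complex) \<Rightarrow> ('i \<Rightarrow> complex) \<Rightarrow> complex" where
  "herm_form S A v = (\<Sum>i\<in>S. \<Sum>j\<in>S. A i j * v j * cnj (v i))"

lemma herm_form_insert:
  assumes "finite S" "a \<notin> S"
  shows "herm_form (insert a S) A (u(a := z)) =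
    herm_form S A u + z * (\<Sum>i\<in>S. A i a * cnj (u i)) + cnj z * (\<Sum>j\<in>S. A a j * u j) + z * cnj z * A a a"
proof -
  have "\<And>i. i \<in> S \<Longrightarrow> i \<noteq> a" using assms by auto
  then show ?thesis using assms
    by (simp add: herm_form_def sum.distrib sum_distrib_left sum_distrib_right algebra_simps cong: sum.cong)
qed

lemma herm_form_mono_domain:
  assumes "finite S" "a \<notin> S" "\<And>v. 0 \<le> herm_form (insert a S) A v"
  shows "0 \<le> herm_form S A v"
  using assms(3)[of "v(a := 0)"] herm_form_insert[OF assms(1,2), of A v 0] by simp

text \<open>Induction on the dimension: splitting off a rank-one term leaves the Schur complement of one
  diagonal entry, whose row and column vanish. If that entry is zero then so are its row and column,
  and the division below harmlessly yields zero.\<close>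

lemma trace_product_nonneg:
  assumes "finite S" "\<And>v. 0 \<le> herm_form S A v" "\<And>v. 0 \<le> herm_form S B v"
  shows "0 \<le> (\<Sum>i\<in>S. \<Sum>j\<in>S. A i j * B j i)"
  using assms
proof (induction S arbitrary: A rule: finite_induct)
  case empty
  then show ?case by simp
next
  case (insert a S)
  define d where "d = A a a"
  define L where "L u = (\<Sum>j\<in>S. A a j * u j)" for u
  define R where "R u = (\<Sum>i\<in>S. A i a * cnj (u i))" for u
  have q: "0 \<le> herm_form S A u + z * R u + cnj z * L u + z * cnj z * d" for u z
    using insert.prems(1)[of "u(a := z)"]
    unfolding herm_form_insert[OF insert.hyps(1,2)] L_def R_def d_def .
  note Q = quadratic_form_nonneg[OF q]
  have d: "0 \<le> d" by (rule Q)
  \<comment> \<open>Unit vectors turn statements about the functionals \<open>L\<close> and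
    \<open>R\<close> into statements about single entries of \<open>A\<close>.\<close>
  have Lj: "L (\<lambda>k. if k = j then 1 else 0) = A a j" if "j \<in> S" for j
    using that insert.hyps by (simp add: L_def if_distrib cong: if_cong)
  have Rj: "R (\<lambda>k. if k = j then 1 else 0) = A j a" if "j \<in> S" for j
    using that insert.hyps by (simp add: R_def if_distrib cong: if_cong)
  have dc: "cnj d = d" using d by (simp add: less_eq_complex_def complex_eq_iff)
  have herm: "A j a = cnj (A a j)" if "j \<in> insert a S" for j
    using that Q(2)[of "\<lambda>k. if k = j then 1 else 0"] Lj Rj dc by (auto simp: d_def)
  have zero: "A a j = 0" if "d = 0" "j \<in> insert a S" for j
    using that Q(3)[of "\<lambda>k. if k = j then 1 else 0"] Lj by (auto simp: d_def)
  define A' where "A' i j = A i j - A i a * A a j / d" for i j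
  have "0 \<le> herm_form S A' v" for v
  proof -
    have "R v * L v / d = (\<Sum>i\<in>S. \<Sum>j\<in>S. A i a * A a j / d * v j * cnj (v i))"
      unfolding L_def R_def sum_product sum_divide_distrib by (intro sum.cong refl) simp
    then have "herm_form S A' v = herm_form S A v - R v * L v / d"
      by (simp add: herm_form_def A'_def left_diff_distrib sum_subtractf)
    then show ?thesis using Q(4) by simp
  qed
  moreover have "0 \<le> herm_form S B v" for v
    using insert.prems(2) herm_form_mono_domain[OF insert.hyps(1,2)] by blast
  ultimately have IH: "0 \<le> (\<Sum>i\<in>S. \<Sum>j\<in>S. A' i j * B j i)" by (rule insert.IH)
  have A'0: "A' a j = 0" "A' j a = 0" if "j \<in> insert a S" for j
    using that zero herm by (auto simp: A'_def d_def[symmetric])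
  have S: "(\<Sum>i\<in>insert a S. \<Sum>j\<in>insert a S. A' i j * B j i) = (\<Sum>i\<in>S. \<Sum>j\<in>S. A' i j * B j i)"
    using insert.hyps A'0 by (simp add: sum.insert)
  have "(\<Sum>i\<in>insert a S. \<Sum>j\<in>insert a S. A i j * B j i)
    = (\<Sum>i\<in>insert a S. \<Sum>j\<in>insert a S. A' i j * B j i) + (\<Sum>i\<in>insert a S. \<Sum>j\<in>insert a S. A i a * A a j / d * B j i)"
    by (subst sum.distrib[symmetric])+ (simp add: A'_def algebra_simps)
  \<comment> \<open>By Hermitian symmetry the rank-one term contributes the form of \<open>B\<close>
    at column \<open>a\<close> of \<open>A\<close>, divided by \<open>d\<close>.\<close>
  also have "(\<Sum>i\<in>insert a S. \<Sum>j\<in>insert a S. A i a * A a j / d * B j i)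
     = (\<Sum>j\<in>insert a S. \<Sum>i\<in>insert a S. B j i * A i a * cnj (A j a)) / d"
    unfolding sum_divide_distrib by (subst sum.swap, intro sum.cong refl) (auto simp: herm)
  also have "\<dots> = herm_form (insert a S) B (\<lambda>i. A i a) / d"
    by (simp add: herm_form_def)
  finally show ?case
    using IH S complex_divide_nonneg[OF d insert.prems(2)[of "\<lambda>i. A i a"]] by simp
qed

section \<open>Classical tests and the Renyi divergence\<close>

text \<open>The threshold is the largest likelihood ratio whose superlevel set has
  \<open>p\<close>-mass at least \<open>1 - \<epsilon>\<close>, with randomisation on ties. If that
  much mass already sits where \<open>q\<close> vanishes, accepting there has error zero; this is
  the first alternative.\<close>

lemma neyman_pearson_test:
  fixes p q :: "'x \<Rightarrow> real"
  assumes X: "finite X" and p: "\<And>x. x \<in> X \<Longrightarrow> 0 \<le> p x" and q: "\<And>x. x \<in> X \<Longrightarrow> 0 \<le> q x"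
    and sum_p: "sum p X = 1" and eps: "0 < \<epsilon>" "\<epsilon> < 1"
  shows "\<exists>t. (\<forall>x\<in>X. 0 \<le> t x \<and> t x \<le> 1) \<and> 1 - \<epsilon> \<le> (\<Sum>x\<in>X. t x * p x) \<and>
    ((\<Sum>x\<in>X. t x * q x) = 0 \<or>
      (\<exists>\<mu>>0. \<epsilon> + \<mu> * (\<Sum>x\<in>X. t x * q x) \<le> (\<Sum>x\<in>X. min (p x) (\<mu> * q x))))"
proof (cases "1 - \<epsilon> \<le> sum p {x \<in> X. q x = 0}")
  case True
  let ?t = "\<lambda>x. if q x = 0 then 1 else 0 :: real"
  have "(\<Sum>x\<in>X. ?t x * p x) = sum p {x \<in> X. q x = 0}"
    using X by (intro sum.mono_neutral_cong_right) auto
  moreover have "(\<Sum>x\<in>X. ?t x * q x) = 0" by (intro sum.neutral) auto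
  ultimately show ?thesis using True by (intro exI[of _ ?t]) simp
next
  case False
  \<comment> \<open>Comparing \<open>m * q x\<close> with \<open>p x\<close> avoids the quotient, so
    points with \<open>q x = 0\<close> belong to every superlevel set.\<close>
  define M where "M = {m \<in> (\<lambda>x. p x / q x) ` {x \<in> X. 0 < p x \<and> 0 < q x}. 1 - \<epsilon> \<le> sum p {x \<in> X. m * q x \<le> p x}}"
  define P where "P = {x \<in> X. 0 < p x \<and> 0 < q x}"
  have fin: "finite M" using X by (auto simp: M_def)
  have "P \<noteq> {}"
  proof
    assume "P = {}"
    then have "sum p {x \<in> X. q x = 0} = sum p X"
      using X p q by (intro sum.mono_neutral_left) (fastforce simp: P_def order_less_le)+
    then show False using False sum_p eps by simp
  qed
  \<comment> \<open>The superlevel set of the smallest ratio carries all of \<open>p\<close>, so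
    \<open>M\<close> is nonempty and has a maximum.\<close>
  define m0 where "m0 = Min ((\<lambda>x. p x / q x) ` P)"
  have finP: "finite P" using X by (simp add: P_def)
  have m0: "m0 \<in> (\<lambda>x. p x / q x) ` P" unfolding m0_def using finP \<open>P \<noteq> {}\<close> by (intro Min_in) auto
  have "sum p {x \<in> X. m0 * q x \<le> p x} = sum p X"
  proof (intro sum.mono_neutral_left X ballI)
    fix x assume x: "x \<in> X - {x \<in> X. m0 * q x \<le> p x}"
    show "p x = 0"
    proof (rule ccontr)
      assume "p x \<noteq> 0"
      then have "0 < p x" using x p[of x] by auto
      moreover have "0 < q x" using x \<open>0 < p x\<close> q[of x] by (cases "q x = 0") auto
      ultimately have "x \<in> P" using x by (auto simp: P_def)
      then have "m0 \<le> p x / q x" unfolding m0_def using finP by simp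
      then show False using x \<open>0 < q x\<close> by (simp add: field_simps)
    qed
  qed auto
  then have "m0 \<in> M" using m0 sum_p eps by (auto simp: M_def P_def)
  define \<mu> where "\<mu> = Max M"
  have \<mu>M: "\<mu> \<in> M" unfolding \<mu>_def using fin \<open>m0 \<in> M\<close> by (intro Max_in) auto
  then have \<mu>: "0 < \<mu>" "1 - \<epsilon> \<le> sum p {x \<in> X. \<mu> * q x \<le> p x}" by (auto simp: M_def)
  define G where "G = {x \<in> X. \<mu> * q x < p x}"
  define E where "E = {x \<in> X. \<mu> * q x = p x}"
  have finGE: "finite G" "finite E" using X by (auto simp: G_def E_def)
  \<comment> \<open>By maximality of \<open>\<mu>\<close>: either \<open>G\<close> lies where
    \<open>q\<close> vanishes, or it is contained in the superlevel set of \<open>m1\<close>, the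
    smallest ratio on \<open>G \<inter> P\<close>, which exceeds \<open>\<mu>\<close> and hence is
    not in \<open>M\<close>.\<close>
  have less: "sum p G < 1 - \<epsilon>"
  proof (cases "G \<inter> P = {}")
    case True
    have "sum p G \<le> sum p {x \<in> X. q x = 0}"
    proof (rule sum_mono2)
      show "G \<subseteq> {x \<in> X. q x = 0}"
      proof
        fix x assume x: "x \<in> G"
        then have "x \<in> X" "\<mu> * q x < p x" by (auto simp: G_def)
        moreover have "0 \<le> \<mu> * q x" using \<mu> q \<open>x \<in> X\<close> by simp
        ultimately show "x \<in> {x \<in> X. q x = 0}" using True x q[of x] by (auto simp: P_def)
      qed
    qed (use X p in auto)
    then show ?thesis using False by simp
  next
    case nonempty: False
    define m1 where "m1 = Min ((\<lambda>x. p x / q x) ` (G \<inter> P))"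
    have m1: "m1 \<in> (\<lambda>x. p x / q x) ` (G \<inter> P)" unfolding m1_def using finP nonempty by (intro Min_in) auto
    then have "\<mu> < m1" by (auto simp: G_def P_def field_simps)
    have "m1 \<notin> M" using Max_ge[OF fin, of m1] \<open>\<mu> < m1\<close> unfolding \<mu>_def by auto
    then have "sum p {x \<in> X. m1 * q x \<le> p x} < 1 - \<epsilon>" using m1 by (auto simp: M_def P_def)
    moreover have "sum p G \<le> sum p {x \<in> X. m1 * q x \<le> p x}"
    proof (rule sum_mono2)
      show "G \<subseteq> {x \<in> X. m1 * q x \<le> p x}"
      proof
        fix x assume x: "x \<in> G"
        then have xX: "x \<in> X" and gt: "\<mu> * q x < p x" by (auto simp: G_def)
        show "x \<in> {x \<in> X. m1 * q x \<le> p x}"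
        proof (cases "q x = 0")
          case True then show ?thesis using xX p by simp
        next
          case False
          then have "0 < q x" using q[OF xX] by simp
          moreover have "0 < p x" using gt \<open>0 < q x\<close> \<mu> by (smt (verit) mult_pos_pos)
          ultimately have "x \<in> G \<inter> P" using x xX by (auto simp: P_def)
          then have "m1 \<le> p x / q x" unfolding m1_def using finP by simp
          then show ?thesis using xX \<open>0 < q x\<close> by (simp add: field_simps)
        qed
      qed
    qed (use X p in auto)
    ultimately show ?thesis by simp
  qed
  have "{x \<in> X. \<mu> * q x \<le> p x} = G \<union> E" "G \<inter> E = {}" by (auto simp: G_def E_def)
  then have split: "1 - \<epsilon> \<le> sum p G + sum p E" using \<mu> finGE by (simp add: sum.union_disjoint)
  \<comment> \<open>Accepting ties with probability \<open>c\<close> makes the \<open>p\<close>-mass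
    exactly \<open>1 - \<epsilon>\<close>.\<close>
  define c where "c = (1 - \<epsilon> - sum p G) / sum p E"
  have "0 < sum p E" using less split by simp
  then have c: "0 \<le> c" "c \<le> 1" "c * sum p E = 1 - \<epsilon> - sum p G" using less split by (auto simp: c_def)
  define t where "t x = (if \<mu> * q x < p x then 1 else if \<mu> * q x = p x then c else 0)" for x
  have t_sum: "(\<Sum>x\<in>X. t x * f x) = sum f G + c * sum f E" for f :: "'x \<Rightarrow> real"
  proof -
    have "(\<Sum>x\<in>X. t x * f x) = (\<Sum>x\<in>X. (if \<mu> * q x < p x then f x else 0) + (if \<mu> * q x = p x then c * f x else 0))"
      by (intro sum.cong) (auto simp: t_def)
    then show ?thesis using X by (simp add: sum.distrib G_def E_def sum.If_cases sum_distrib_left Int_def)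
  qed
  have tp: "(\<Sum>x\<in>X. t x * p x) = 1 - \<epsilon>" using t_sum[of p] c by simp
  \<comment> \<open>This holds pointwise: \<open>t x\<close> is 1 where \<open>\<mu> * q x\<close>
    is the minimum, 0 where \<open>p x\<close> is, and on ties its value cancels.\<close>
  have "(\<Sum>x\<in>X. min (p x) (\<mu> * q x)) = (\<Sum>x\<in>X. p x - t x * p x + \<mu> * (t x * q x))"
    by (intro sum.cong) (auto simp: t_def min_def algebra_simps)
  also have "\<dots> = 1 - (1 - \<epsilon>) + \<mu> * (\<Sum>x\<in>X. t x * q x)"
    using tp sum_p by (simp add: sum.distrib sum_subtractf sum_distrib_left)
  finally have "\<epsilon> + \<mu> * (\<Sum>x\<in>X. t x * q x) \<le> (\<Sum>x\<in>X. min (p x) (\<mu> * q x))" by simp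
  moreover have "\<forall>x\<in>X. 0 \<le> t x \<and> t x \<le> 1" using c by (simp add: t_def)
  ultimately show ?thesis using \<mu>(1) tp by (intro exI[of _ t]) auto
qed

section \<open>Inequalities between means and bounds on Renyi sums\<close>

lemma ln_weighted_mean:
  fixes u v a :: real
  assumes "0 < u" "0 < v" "0 \<le> a" "a \<le> 1"
  shows "a * ln u + (1 - a) * ln v \<le> ln (a * u + (1 - a) * v)"
  using concave_onD[OF ln_concave, of "1 - a" u v] assms by simp

lemma powr_weighted_mean:
  fixes u v a :: real
  assumes "0 \<le> u" "0 \<le> v" "0 < a" "a < 1"
  shows "u powr a * v powr (1 - a) \<le> a * u + (1 - a) * v"
proof (cases "u = 0 \<or> v = 0")
  case True
  then show ?thesis using assms by auto
next
  case False
  then show ?thesis using Youngs_inequality_0[of a "1 - a" u v] assms by simp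
qed

lemma min_le_powr_mult_powr:
  fixes x y a :: real
  assumes "0 \<le> x" "0 \<le> y" "0 < a" "a < 1"
  shows "min x y \<le> x powr a * y powr (1 - a)"
proof -
  have "min x y = min x y powr a * min x y powr (1 - a)"
    using assms by (simp flip: powr_add)
  also have "\<dots> \<le> x powr a * y powr (1 - a)"
    using assms by (intro mult_mono powr_mono2) auto
  finally show ?thesis .
qed

definition renyi_sum :: "real \<Rightarrow> 'x set \<Rightarrow> ('x \<Rightarrow> real) \<Rightarrow> ('x \<Rightarrow> real) \<Rightarrow> real" where
  "renyi_sum a X p q = (\<Sum>x\<in>X. p x powr a * q x powr (1 - a))"

lemma renyi_sum_nonneg: "0 \<le> renyi_sum a X p q"
  unfolding renyi_sum_def by (intro sum_nonneg) auto

text \<open>Positivity depends on the supports alone, so it transfers between orders and excludes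
  the infinite branch of the divergence below order 1.\<close>

lemma renyi_sum_pos_iff:
  assumes "finite X" "\<And>x. x \<in> X \<Longrightarrow> 0 \<le> p x" "\<And>x. x \<in> X \<Longrightarrow> 0 \<le> q x"
  shows "0 < renyi_sum a X p q \<longleftrightarrow> supp X p \<inter> supp X q \<noteq> {}"
proof -
  have "renyi_sum a X p q = 0 \<longleftrightarrow> (\<forall>x\<in>X. p x = 0 \<or> q x = 0)"
    unfolding renyi_sum_def using assms by (subst sum_nonneg_eq_0_iff) auto
  also have "\<dots> \<longleftrightarrow> supp X p \<inter> supp X q = {}"
    using assms by (fastforce simp: supp_def order_less_le)
  finally show ?thesis using renyi_sum_nonneg[of a X p q] by (auto simp: order_less_le)
qed

lemma log_test_le_log_renyi_sum:
  assumes X: "finite X" and p: "\<And>x. x \<in> X \<Longrightarrow> 0 \<le> p x" and q: "\<And>x. x \<in> X \<Longrightarrow> 0 \<le> q x"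
    and a: "0 < a" "a < 1" and "0 < \<epsilon>" "0 < \<beta>" "0 < \<mu>"
    and le: "\<epsilon> + \<mu> * \<beta> \<le> (\<Sum>x\<in>X. min (p x) (\<mu> * q x))"
  shows "0 < renyi_sum a X p q"
    "log 2 \<beta> \<le> log 2 (1 - a) + a / (1 - a) * log 2 (a / \<epsilon>) + log 2 (renyi_sum a X p q) / (1 - a)"
proof -
  have "(\<Sum>x\<in>X. min (p x) (\<mu> * q x)) \<le> (\<Sum>x\<in>X. p x powr a * (\<mu> * q x) powr (1 - a))"
    using p q a \<open>0 < \<mu>\<close> by (intro sum_mono min_le_powr_mult_powr) auto
  also have "\<dots> = \<mu> powr (1 - a) * renyi_sum a X p q"
    unfolding renyi_sum_def sum_distrib_left using q \<open>0 < \<mu>\<close> 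
    by (intro sum.cong) (auto simp: powr_mult)
  finally have bd: "\<epsilon> + \<mu> * \<beta> \<le> \<mu> powr (1 - a) * renyi_sum a X p q" using le by simp
  moreover have pos: "0 < \<epsilon> + \<mu> * \<beta>" using assms by (simp add: add_pos_pos)
  ultimately have "0 < \<mu> powr (1 - a) * renyi_sum a X p q" by linarith
  then show Q: "0 < renyi_sum a X p q" using \<open>0 < \<mu>\<close> by (simp add: zero_less_mult_iff)
  let ?l = "ln (renyi_sum a X p q)"
  \<comment> \<open>The two points are scaled so that their weighted mean is
    \<open>\<epsilon> + \<mu> * \<beta>\<close>. Both ends of the chain then contain
    \<open>(1 - a) * ln \<mu>\<close>, which cancels.\<close>
  have "a * ln (\<epsilon> / a) + (1 - a) * ln (\<mu> * \<beta> / (1 - a)) \<le> ln (a * (\<epsilon> / a) + (1 - a) * (\<mu> * \<beta> / (1 - a)))"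
    using assms by (intro ln_weighted_mean) auto
  also have "a * (\<epsilon> / a) + (1 - a) * (\<mu> * \<beta> / (1 - a)) = \<epsilon> + \<mu> * \<beta>" using a by simp
  also have "ln (\<epsilon> + \<mu> * \<beta>) \<le> ln (\<mu> powr (1 - a) * renyi_sum a X p q)"
    using bd pos by (subst ln_le_cancel_iff) auto
  also have "\<dots> = (1 - a) * ln \<mu> + ?l"
    using Q \<open>0 < \<mu>\<close> by (simp add: ln_mult ln_powr)
  finally have "(1 - a) * ln \<beta> \<le> (1 - a) * ln (1 - a) + a * ln (a / \<epsilon>) + ?l"
    using assms by (simp add: ln_mult ln_div algebra_simps)
  then have "(1 - a) * ln \<beta> \<le> (1 - a) * (ln (1 - a) + a / (1 - a) * ln (a / \<epsilon>) + ?l / (1 - a))"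
    using a by (simp add: distrib_left)
  then have "ln \<beta> \<le> ln (1 - a) + a / (1 - a) * ln (a / \<epsilon>) + ?l / (1 - a)"
    using a by (simp only: mult_le_cancel_left_pos)
  then have "ln \<beta> / ln 2 \<le> (ln (1 - a) + a / (1 - a) * ln (a / \<epsilon>) + ?l / (1 - a)) / ln 2"
    by (intro divide_right_mono) auto
  then show "log 2 \<beta> \<le> log 2 (1 - a) + a / (1 - a) * log 2 (a / \<epsilon>) + log 2 (renyi_sum a X p q) / (1 - a)"
    by (simp add: log_def add_divide_distrib mult.commute)
qed

text \<open>Hoelder's inequality with exponents \<open>\<theta>\<close> and \<open>1 - \<theta>\<close> for
  \<open>p\<^sup>b q\<^sup>1\<^sup>-\<^sup>b = (p\<^sup>a q\<^sup>1\<^sup>-\<^sup>a)\<^sup>\<theta> p\<^sup>1\<^sup>-\<^sup>\<theta>\<close>.\<close>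

lemma log_renyi_sum_mono:
  assumes X: "finite X" and p: "\<And>x. x \<in> X \<Longrightarrow> 0 \<le> p x" and q: "\<And>x. x \<in> X \<Longrightarrow> 0 \<le> q x"
    and sum_p: "sum p X = 1" and ab: "0 < a" "a \<le> b" "b < 1" and Q: "0 < renyi_sum b X p q"
  shows "log 2 (renyi_sum b X p q) / (1 - b) \<le> log 2 (renyi_sum a X p q) / (1 - a)"
proof (cases "a = b")
  case False
  then have ab': "a < b" using ab by simp
  have Qa: "0 < renyi_sum a X p q" 
    using Q renyi_sum_pos_iff[of X p q] X p q by blast
  let ?Q = "renyi_sum a X p q"
  \<comment> \<open>This exponent matches the power of \<open>q\<close>, and the power of
    \<open>p\<close> then comes out as \<open>b\<close>.\<close>
  define \<theta> where "\<theta> = (1 - b) / (1 - a)"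
  have th: "0 < \<theta>" "\<theta> < 1" using ab ab' by (auto simp: \<theta>_def)
  have "(1 - a) * \<theta> = 1 - b" using ab by (simp add: \<theta>_def)
  then have e1: "a * \<theta> + (1 - \<theta>) = b" "(1 - a) * \<theta> = 1 - b" by (simp_all add: algebra_simps)
  have "renyi_sum b X p q / ?Q powr \<theta> = (\<Sum>x\<in>X. (p x powr a * q x powr (1 - a) / ?Q) powr \<theta> * p x powr (1 - \<theta>))"
    unfolding renyi_sum_def[of b] sum_divide_distrib
  proof (intro sum.cong refl)
    fix x assume x: "x \<in> X"
    have "(p x powr a * q x powr (1 - a) / ?Q) powr \<theta> * p x powr (1 - \<theta>)
      = (p x powr (a * \<theta>) * p x powr (1 - \<theta>)) * q x powr ((1 - a) * \<theta>) / ?Q powr \<theta>"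
      using Qa by (simp add: powr_divide powr_mult powr_powr)
    also have "\<dots> = p x powr b * q x powr (1 - b) / ?Q powr \<theta>"
      unfolding e1 by (simp flip: powr_add add: e1)
    finally show "p x powr b * q x powr (1 - b) / ?Q powr \<theta>
      = (p x powr a * q x powr (1 - a) / ?Q) powr \<theta> * p x powr (1 - \<theta>)" by simp
  qed
  \<comment> \<open>After dividing by \<open>?Q\<close> both factors have total mass 1, so pointwise
    weighted AM-GM sums to \<open>\<theta> + (1 - \<theta>) = 1\<close>.\<close>
  also have "\<dots> \<le> (\<Sum>x\<in>X. \<theta> * (p x powr a * q x powr (1 - a) / ?Q) + (1 - \<theta>) * p x)"
    using p Qa th by (intro sum_mono powr_weighted_mean) auto
  also have "\<dots> = \<theta> * (?Q / ?Q) + (1 - \<theta>) * sum p X"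
    by (simp only: sum.distrib sum_distrib_left[symmetric] sum_divide_distrib[symmetric] renyi_sum_def)
  also have "\<dots> = 1" using Qa sum_p by simp
  finally have "renyi_sum b X p q \<le> ?Q powr \<theta>" using Qa by simp
  then have "log 2 (renyi_sum b X p q) \<le> \<theta> * log 2 ?Q"
    using Q Qa by (metis log_le_cancel_iff log_powr one_less_numeral_iff powr_gt_zero semiring_norm(76) less_irrefl)
  then show ?thesis using ab by (simp add: \<theta>_def field_simps)
qed simp

text \<open>For \<open>a > 0\<close> this is the bound of order \<open>b\<close>, carried down to
  \<open>a\<close> by monotonicity. The constant has derivative a positive multiple of
  \<open>log 2 (b / \<epsilon>)\<close> in \<open>b\<close>, so \<open>max a \<epsilon>\<close> is
  the best order in \<open>[a, 1)\<close>.\<close>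

lemma renyi_div_minus_le_neg_log2_test:
  fixes p q :: "'x \<Rightarrow> real"
  assumes X: "finite X" and p: "\<And>x. x \<in> X \<Longrightarrow> 0 \<le> p x" and q: "\<And>x. x \<in> X \<Longrightarrow> 0 \<le> q x"
    and sum_p: "sum p X = 1" and eps: "0 < \<epsilon>" "\<epsilon> < 1" and a: "0 \<le> a" "a < 1" and b: "b = max a \<epsilon>"
  obtains t where "\<And>x. x \<in> X \<Longrightarrow> 0 \<le> t x" "\<And>x. x \<in> X \<Longrightarrow> t x \<le> 1"
    "1 - \<epsilon> \<le> (\<Sum>x\<in>X. t x * p x)"
    "renyi_div (ereal a) X p q - ereal (b / (1 - b) * log 2 (b / \<epsilon>) + log 2 (1 - b))
      \<le> neg_log2 (\<Sum>x\<in>X. t x * q x)"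
proof (cases "a = 0")
  case True
  \<comment> \<open>The factor \<open>1 - \<epsilon>\<close> lowers the \<open>p\<close>-mass to
    exactly \<open>1 - \<epsilon>\<close> and shifts \<open>neg_log2\<close> by minus the constant,
    which is \<open>log 2 (1 - \<epsilon>)\<close> because \<open>b = \<epsilon>\<close>.\<close>
  let ?t = "\<lambda>x. if x \<in> supp X p then 1 - \<epsilon> else 0"
  have t_sum: "(\<Sum>x\<in>X. ?t x * f x) = (1 - \<epsilon>) * sum f (supp X p)" for f :: "'x \<Rightarrow> real"
    unfolding sum_distrib_left using X by (intro sum.mono_neutral_cong_right) (auto simp: supp_def)
  have "sum p (supp X p) = sum p X"
    using X p by (intro sum.mono_neutral_left) (fastforce simp: supp_def order_less_le)+
  then have "(\<Sum>x\<in>X. ?t x * p x) = 1 - \<epsilon>" using t_sum[of p] sum_p by simp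
  moreover have "b = \<epsilon>" using True b eps by simp
  then have "renyi_div (ereal a) X p q - ereal (b / (1 - b) * log 2 (b / \<epsilon>) + log 2 (1 - b))
      \<le> neg_log2 (\<Sum>x\<in>X. ?t x * q x)"
    unfolding t_sum[of q] using True eps
    by (auto simp: renyi_div_def neg_log2_def mult_le_0_iff log_mult not_le)
  ultimately show thesis using eps by (intro that[of ?t]) auto
next
  case False
  have b01: "0 < b" "b < 1" "a \<le> b" "0 < a" using False a eps b by auto
  obtain t where t: "\<And>x. x \<in> X \<Longrightarrow> 0 \<le> t x" "\<And>x. x \<in> X \<Longrightarrow> t x \<le> 1"
    "1 - \<epsilon> \<le> (\<Sum>x\<in>X. t x * p x)"
    "(\<Sum>x\<in>X. t x * q x) = 0 \<or> (\<exists>\<mu>>0. \<epsilon> + \<mu> * (\<Sum>x\<in>X. t x * q x) \<le> (\<Sum>x\<in>X. min (p x) (\<mu> * q x)))"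
    using neyman_pearson_test[of X p q \<epsilon>, OF X p q sum_p eps] by blast
  define \<beta> where "\<beta> = (\<Sum>x\<in>X. t x * q x)"
  have "renyi_div (ereal a) X p q - ereal (b / (1 - b) * log 2 (b / \<epsilon>) + log 2 (1 - b)) \<le> neg_log2 \<beta>"
  proof (cases "\<beta> \<le> 0")
    case True then show ?thesis by (simp add: neg_log2_def)
  next
    case beta: False
    then obtain \<mu> where \<mu>: "0 < \<mu>" "\<epsilon> + \<mu> * \<beta> \<le> (\<Sum>x\<in>X. min (p x) (\<mu> * q x))"
      using t(4) by (auto simp: \<beta>_def)
    have Q: "0 < renyi_sum b X p q"
      and le: "log 2 \<beta> \<le> log 2 (1 - b) + b / (1 - b) * log 2 (b / \<epsilon>) + log 2 (renyi_sum b X p q) / (1 - b)"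
      using log_test_le_log_renyi_sum[of X p q b \<epsilon> \<beta> \<mu>] X p q b01 eps beta \<mu> by auto
    have "log 2 (renyi_sum b X p q) / (1 - b) \<le> log 2 (renyi_sum a X p q) / (1 - a)"
      using X p q sum_p b01 Q by (intro log_renyi_sum_mono)
    also have "\<dots> = - (1 / (a - 1) * log 2 (renyi_sum a X p q))"
      using a by (simp add: field_simps)
    finally have "1 / (a - 1) * log 2 (renyi_sum a X p q) - (b / (1 - b) * log 2 (b / \<epsilon>) + log 2 (1 - b))
        \<le> - log 2 \<beta>"
      using le by simp
    moreover have "supp X p \<inter> supp X q \<noteq> {}" using Q renyi_sum_pos_iff[of X p q b] X p q by blast
    then have "renyi_div (ereal a) X p q = ereal (1 / (a - 1) * log 2 (renyi_sum a X p q))"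
      using False a by (simp add: renyi_div_def renyi_sum_def one_ereal_def)
    ultimately show ?thesis using beta by (simp add: neg_log2_def)
  qed
  then show thesis using t by (intro that[of t]) (auto simp: \<beta>_def)
qed

section \<open>Measurements and effects\<close>

lemma psd_iff_herm_form:
  "psd n M \<longleftrightarrow> M \<in> carrier_mat n n \<and> (\<forall>v. 0 \<le> herm_form {..<n} (\<lambda>i j. M $$ (i, j)) v)"
proof (cases "M \<in> carrier_mat n n")
  case True
  have *: "(M *\<^sub>v v) \<bullet>c v = herm_form {..<n} (\<lambda>i j. M $$ (i, j)) (\<lambda>i. v $ i)" if "v \<in> carrier_vec n" for v
    using that True
    by (auto simp: herm_form_def scalar_prod_def sum_distrib_right atLeast0LessThan intro!: sum.cong)
  have "herm_form {..<n} (\<lambda>i j. M $$ (i, j)) v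
      = herm_form {..<n} (\<lambda>i j. M $$ (i, j)) (\<lambda>i. vec n v $ i)" for v
    by (simp add: herm_form_def)
  then show ?thesis using True * unfolding psd_def by (metis vec_carrier)
qed (simp add: psd_def)

lemma psd_carrier: "psd n M \<Longrightarrow> M \<in> carrier_mat n n"
  by (simp add: psd_def)

lemma psd_diag_nonneg:
  assumes "psd n M" "i < n"
  shows "0 \<le> M $$ (i, i)"
proof -
  have "insert i ({..<n} - {i}) = {..<n}" using assms(2) by auto
  then have "herm_form {..<n} (\<lambda>i j. M $$ (i, j)) ((\<lambda>_. 0)(i := 1)) = M $$ (i, i)"
    using herm_form_insert[of "{..<n} - {i}" i "\<lambda>i j. M $$ (i, j)" "\<lambda>_. 0" 1] by (simp add: herm_form_def)
  then show ?thesis using assms unfolding psd_iff_herm_form by metis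
qed

lemma mat_trace_mult:
  assumes "A \<in> carrier_mat n n" "B \<in> carrier_mat n n"
  shows "mat_trace (A * B) = (\<Sum>i<n. \<Sum>j<n. A $$ (i, j) * B $$ (j, i))"
  using assms by (auto simp: mat_trace_def scalar_prod_def atLeast0LessThan intro!: sum.cong)

text \<open>This makes measurement outcomes nonnegative and bounds the infimum in
  \<open>hyp_test_div\<close> from below.\<close>

lemma psd_mat_trace_mult_nonneg:
  assumes "psd n A" "psd n B"
  shows "0 \<le> mat_trace (A * B)"
  using assms unfolding mat_trace_mult[OF assms[THEN psd_carrier]]
  by (intro trace_product_nonneg) (auto simp: psd_iff_herm_form)

lemma psd_one: "psd n (1\<^sub>m n)"
  unfolding psd_def
proof (intro conjI ballI)
  fix v :: "complex vec" assume "v \<in> carrier_vec n"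
  then show "0 \<le> (1\<^sub>m n *\<^sub>v v) \<bullet>c v"
    by (simp add: scalar_prod_def) (intro sum_nonneg, auto simp: less_eq_complex_def)
qed simp

lemma psd_zero: "psd n (0\<^sub>m n n)"
  by (auto simp: psd_iff_herm_form herm_form_def)

text \<open>The effect of measuring \<open>E\<close> and accepting outcome \<open>x\<close> with
  probability \<open>t x\<close>. The entrywise form agrees with the completeness condition in
  \<open>povm\<close>.\<close>

definition povm_test :: "nat \<Rightarrow> nat \<Rightarrow> (nat \<Rightarrow> complex mat) \<Rightarrow> (nat \<Rightarrow> real) \<Rightarrow> complex mat" where
  "povm_test n m E t = mat n n (\<lambda>ij. \<Sum>x<m. complex_of_real (t x) * E x $$ ij)"

lemma povm_test_carrier: "povm_test n m E t \<in> carrier_mat n n"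
  by (simp add: povm_test_def)

lemma sum_rotate:
  "(\<Sum>i\<in>I. \<Sum>j\<in>J. \<Sum>k\<in>K. f i j k) = (\<Sum>k\<in>K. \<Sum>i\<in>I. \<Sum>j\<in>J. f i j k)"
  by (rule trans[OF sum.cong[OF refl sum.swap] sum.swap])

lemma psd_povm_test:
  assumes "\<And>x. x < m \<Longrightarrow> psd n (E x)" "\<And>x. x < m \<Longrightarrow> 0 \<le> t x"
  shows "psd n (povm_test n m E t)"
  unfolding psd_iff_herm_form
proof (intro conjI allI povm_test_carrier)
  fix v
  have "herm_form {..<n} (\<lambda>i j. povm_test n m E t $$ (i, j)) v
    = (\<Sum>i<n. \<Sum>j<n. \<Sum>x<m. complex_of_real (t x) * (E x $$ (i, j) * v j * cnj (v i)))"
    unfolding herm_form_def by (intro sum.cong) (auto simp: povm_test_def sum_distrib_right mult.assoc)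
  also have "\<dots> = (\<Sum>x<m. complex_of_real (t x) * herm_form {..<n} (\<lambda>i j. E x $$ (i, j)) v)"
    unfolding herm_form_def sum_distrib_left by (rule sum_rotate)
  also have "0 \<le> \<dots>"
    using assms by (intro sum_nonneg mult_nonneg_nonneg) (auto simp: psd_iff_herm_form less_eq_complex_def)
  finally show "0 \<le> herm_form {..<n} (\<lambda>i j. povm_test n m E t $$ (i, j)) v" .
qed

lemma povm_test_one: "povm n m E \<Longrightarrow> povm_test n m E (\<lambda>_. 1) = 1\<^sub>m n"
  by (simp add: povm_test_def povm_def)

text \<open>Rejecting is again a test of this form, so both halves of \<open>effect\<close> reduce
  to \<open>psd_povm_test\<close>.\<close>

lemma one_minus_povm_test:
  assumes "povm n m E"
  shows "1\<^sub>m n - povm_test n m E t = povm_test n m E (\<lambda>x. 1 - t x)"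
  unfolding povm_test_one[OF assms, symmetric]
  by (intro eq_matI) (auto simp: povm_test_def sum_subtractf left_diff_distrib)

lemma effect_povm_test:
  assumes "povm n m E" "\<And>x. x < m \<Longrightarrow> 0 \<le> t x" "\<And>x. x < m \<Longrightarrow> t x \<le> 1"
  shows "effect n (povm_test n m E t)"
  unfolding effect_def one_minus_povm_test[OF assms(1)]
  using assms by (auto intro!: psd_povm_test simp: povm_def)

text \<open>By linearity of the trace, the lifted test has the same acceptance probabilities as the
  classical one.\<close>

lemma trace_povm_test:
  assumes "povm n m E" "M \<in> carrier_mat n n"
  shows "Re (mat_trace (povm_test n m E t * M)) = (\<Sum>x<m. t x * measure_out E M x)"
proof -
  have "mat_trace (povm_test n m E t * M) = (\<Sum>i<n. \<Sum>j<n. \<Sum>x<m. complex_of_real (t x) * (E x $$ (i, j) * M $$ (j, i)))"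
    unfolding mat_trace_mult[OF povm_test_carrier assms(2)]
    by (intro sum.cong) (auto simp: povm_test_def sum_distrib_right mult.assoc)
  also have "\<dots> = (\<Sum>x<m. complex_of_real (t x) * (\<Sum>i<n. \<Sum>j<n. E x $$ (i, j) * M $$ (j, i)))"
    unfolding sum_distrib_left by (rule sum_rotate)
  also have "\<dots> = (\<Sum>x<m. complex_of_real (t x) * mat_trace (E x * M))"
    using assms by (intro sum.cong) (auto simp: mat_trace_mult[OF psd_carrier assms(2)] povm_def)
  finally show ?thesis by (simp add: measure_out_def)
qed

lemma measure_out_nonneg:
  assumes "povm n m E" "psd n M" "x < m"
  shows "0 \<le> measure_out E M x"
  using psd_mat_trace_mult_nonneg[of n "E x" M] assms
  by (auto simp: povm_def measure_out_def less_eq_complex_def)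

lemma sum_measure_out:
  assumes "povm n m E" "M \<in> density n"
  shows "(\<Sum>x<m. measure_out E M x) = 1"
  using trace_povm_test[of n m E M "\<lambda>_. 1"] assms by (auto simp: povm_test_one density_def psd_def)

section \<open>Upper bound for all states\<close>

lemma neg_log2_antimono: "x \<le> y \<Longrightarrow> neg_log2 y \<le> neg_log2 x"
  by (auto simp: neg_log2_def)

lemma neg_log2_le_hyp_test_div:
  assumes "effect n \<Lambda>" "1 - \<epsilon> \<le> Re (mat_trace (\<Lambda> * \<rho>))" "psd n \<sigma>"
  shows "neg_log2 (Re (mat_trace (\<Lambda> * \<sigma>))) \<le> hyp_test_div \<epsilon> n \<rho> \<sigma>"
  unfolding hyp_test_div_def
proof (intro neg_log2_antimono cInf_lower bdd_belowI[of _ 0])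
  fix y assume "y \<in> {Re (mat_trace (\<Lambda> * \<sigma>)) |\<Lambda>. effect n \<Lambda> \<and> 1 - \<epsilon> \<le> Re (mat_trace (\<Lambda> * \<rho>))}"
  then obtain \<Lambda>' where \<Lambda>': "y = Re (mat_trace (\<Lambda>' * \<sigma>))" "psd n \<Lambda>'" by (auto simp: effect_def)
  show "0 \<le> y" using psd_mat_trace_mult_nonneg[OF \<Lambda>'(2) assms(3)] \<Lambda>'(1) by (simp add: less_eq_complex_def)
qed (use assms in auto)

lemma nu_H_le:
  assumes eps: "0 < \<epsilon>" "\<epsilon> < 1" and a: "0 \<le> a" "a < 1" and b: "b = max a \<epsilon>"
  shows "nu_H \<epsilon> (ereal a) \<le> ereal (b / (1 - b) * log 2 (b / \<epsilon>) + log 2 (1 - b))"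
  unfolding nu_H_le_iff
proof (intro allI ballI)
  fix n \<rho> \<sigma> assume \<rho>: "\<rho> \<in> density n" and \<sigma>: "\<sigma> \<in> density n"
  let ?\<nu> = "b / (1 - b) * log 2 (b / \<epsilon>) + log 2 (1 - b)"
  have psd: "psd n \<rho>" "psd n \<sigma>" using \<rho> \<sigma> by (auto simp: density_def)
  \<comment> \<open>With the finite constant moved to the right, the supremum is bounded one POVM at
    a time.\<close>
  have "measured_renyi (ereal a) n \<rho> \<sigma> \<le> hyp_test_div \<epsilon> n \<rho> \<sigma> + ereal ?\<nu>"
    unfolding measured_renyi_def
  proof (rule Sup_least, clarify)
    fix m E assume E: "povm n m E"
    obtain t where t: "\<And>x. x < m \<Longrightarrow> 0 \<le> t x" "\<And>x. x < m \<Longrightarrow> t x \<le> 1"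
      "1 - \<epsilon> \<le> (\<Sum>x<m. t x * measure_out E \<rho> x)"
      "renyi_div (ereal a) {..<m} (measure_out E \<rho>) (measure_out E \<sigma>) - ereal ?\<nu>
        \<le> neg_log2 (\<Sum>x<m. t x * measure_out E \<sigma> x)"
      by (rule renyi_div_minus_le_neg_log2_test[OF _ _ _ sum_measure_out[OF E \<rho>] eps a b, where q = "measure_out E \<sigma>"])
        (use measure_out_nonneg[OF E] psd in auto)
    have "neg_log2 (\<Sum>x<m. t x * measure_out E \<sigma> x) \<le> hyp_test_div \<epsilon> n \<rho> \<sigma>"
      using neg_log2_le_hyp_test_div[OF effect_povm_test[OF E t(1,2)], where \<epsilon> = \<epsilon> and \<rho> = \<rho> and \<sigma> = \<sigma>] t(3) psd
      by (simp add: trace_povm_test[OF E] psd_carrier)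
    with t(4) have "renyi_div (ereal a) {..<m} (measure_out E \<rho>) (measure_out E \<sigma>) - ereal ?\<nu>
      \<le> hyp_test_div \<epsilon> n \<rho> \<sigma>" by (rule order_trans)
    then show "renyi_div (ereal a) {..<m} (measure_out E \<rho>) (measure_out E \<sigma>) \<le> hyp_test_div \<epsilon> n \<rho> \<sigma> + ereal ?\<nu>"
      by (simp add: ereal_minus_le)
  qed
  then show "measured_renyi (ereal a) n \<rho> \<sigma> - ereal ?\<nu> \<le> hyp_test_div \<epsilon> n \<rho> \<sigma>"
    by (simp add: ereal_minus_le)
qed

section \<open>Extremal pairs of states\<close>

definition diag2 :: "real \<Rightarrow> real \<Rightarrow> complex mat" where
  "diag2 x y = mat 2 2 (\<lambda>(i, j). if i = j then complex_of_real (if i = 0 then x else y) else 0)"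

lemma diag2_carrier: "diag2 x y \<in> carrier_mat 2 2"
  by (simp add: diag2_def)

lemma psd_diag2:
  assumes "0 \<le> x" "0 \<le> y"
  shows "psd 2 (diag2 x y)"
  unfolding psd_iff_herm_form
proof (intro conjI allI diag2_carrier)
  fix v
  have "{..<2} = {0, 1::nat}" by auto
  then have "herm_form {..<2} (\<lambda>i j. diag2 x y $$ (i, j)) v
      = complex_of_real x * (v 0 * cnj (v 0)) + complex_of_real y * (v 1 * cnj (v 1))"
    by (simp add: herm_form_def diag2_def mult.assoc del: complex_mult_cnj)
  also have "\<dots> = complex_of_real (x * (cmod (v 0))\<^sup>2 + y * (cmod (v 1))\<^sup>2)"
    by (simp only: complex_norm_square of_real_add of_real_mult)
  finally show "0 \<le> herm_form {..<2} (\<lambda>i j. diag2 x y $$ (i, j)) v"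
    using assms by (simp add: less_eq_complex_def)
qed

lemma mat_trace_mult_diag2:
  assumes "M \<in> carrier_mat 2 2"
  shows "mat_trace (M * diag2 x y) = M $$ (0, 0) * complex_of_real x + M $$ (1, 1) * complex_of_real y"
  unfolding mat_trace_mult[OF assms diag2_carrier] by (simp add: diag2_def numeral_2_eq_2)

lemma density_diag2:
  assumes "0 \<le> x" "x \<le> 1"
  shows "diag2 x (1 - x) \<in> density 2"
  using assms psd_diag2[of x "1 - x"] by (simp add: density_def mat_trace_def diag2_def numeral_2_eq_2)

lemma effect_diag:
  assumes "effect n \<Lambda>" "i < n"
  shows "0 \<le> Re (\<Lambda> $$ (i, i))" "Re (\<Lambda> $$ (i, i)) \<le> 1"
  using assms psd_diag_nonneg[of n \<Lambda> i] psd_diag_nonneg[of n "1\<^sub>m n - \<Lambda>" i]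
  by (auto simp: effect_def psd_def less_eq_complex_def)

text \<open>Only the diagonal of an effect matters. Its second entry is at most 1, so feasibility
  forces the first entry \<open>y\<close> to satisfy
  \<open>y * s \<ge> s - \<epsilon>\<close>.\<close>

lemma hyp_test_div_diag2_le:
  assumes eps: "0 < \<epsilon>" "\<epsilon> < s" "s \<le> 1"
  shows "hyp_test_div \<epsilon> 2 (diag2 s (1 - s)) (diag2 1 0) \<le> ereal (- log 2 (1 - \<epsilon> / s))"
proof -
  let ?S = "{Re (mat_trace (\<Lambda> * diag2 1 0)) | \<Lambda>.
      effect 2 \<Lambda> \<and> 1 - \<epsilon> \<le> Re (mat_trace (\<Lambda> * diag2 s (1 - s)))}"
  have "1 - \<epsilon> / s \<le> Inf ?S"
  proof (rule cInf_greatest)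
    \<comment> \<open>The identity is feasible, so the real infimum is over a nonempty set.\<close>
    have "effect 2 (1\<^sub>m 2)" unfolding effect_def using psd_one[of 2] psd_zero[of 2]
      by (metis minus_r_inv_mat one_carrier_mat)
    moreover have "1 - \<epsilon> \<le> Re (mat_trace (1\<^sub>m 2 * diag2 s (1 - s)))"
      using eps by (subst mat_trace_mult_diag2) auto
    ultimately show "?S \<noteq> {}" by blast
  next
    fix y assume "y \<in> ?S"
    then obtain \<Lambda> where \<Lambda>: "effect 2 \<Lambda>" "y = Re (mat_trace (\<Lambda> * diag2 1 0))"
      "1 - \<epsilon> \<le> Re (mat_trace (\<Lambda> * diag2 s (1 - s)))" by auto
    have c: "\<Lambda> \<in> carrier_mat 2 2" using \<Lambda>(1) by (simp add: effect_def psd_def)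
    have y: "y = Re (\<Lambda> $$ (0, 0))" and "1 - \<epsilon> \<le> y * s + Re (\<Lambda> $$ (1, 1)) * (1 - s)"
      using \<Lambda> by (auto simp: mat_trace_mult_diag2[OF c])
    moreover have "Re (\<Lambda> $$ (1, 1)) * (1 - s) \<le> 1 * (1 - s)"
      using effect_diag(2)[OF \<Lambda>(1), of 1] eps by (intro mult_right_mono) auto
    ultimately have "s - \<epsilon> \<le> y * s" by simp
    then show "1 - \<epsilon> / s \<le> y" using eps by (simp add: field_simps)
  qed
  moreover have "0 < 1 - \<epsilon> / s" using eps by simp
  ultimately show ?thesis unfolding hyp_test_div_def
    using neg_log2_antimono[of "1 - \<epsilon> / s"] by (simp add: neg_log2_def)
qed

text \<open>Measuring diagonal states in their eigenbasis returns the classical pair, so the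
  measured divergence is at least the classical one.\<close>

lemma nu_H_ge:
  assumes eps: "0 < \<epsilon>" "\<epsilon> < s" "s \<le> 1"
  shows "renyi_div \<alpha> {..<2} (\<lambda>x::nat. if x = 0 then s else 1 - s) (\<lambda>x. if x = 0 then 1 else 0)
    + ereal (log 2 (1 - \<epsilon> / s)) \<le> nu_H \<epsilon> \<alpha>" (is "renyi_div \<alpha> _ ?p ?q + _ \<le> _")
proof -
  let ?\<rho> = "diag2 s (1 - s)" and ?\<sigma> = "diag2 1 0"
  define E :: "nat \<Rightarrow> complex mat" where "E x = (if x = 0 then diag2 1 0 else diag2 0 1)" for x
  have "povm 2 2 E"
    unfolding povm_def
  proof
    show "mat 2 2 (\<lambda>ij. \<Sum>x<2. E x $$ ij) = 1\<^sub>m 2"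
      by (auto simp: E_def numeral_2_eq_2 diag2_def intro!: eq_matI)
  qed (simp add: E_def psd_diag2)
  moreover have out: "measure_out E (diag2 x y) = (\<lambda>k. if k = 0 then x else y)" for x y
    by (rule ext) (simp add: E_def measure_out_def mat_trace_mult_diag2[OF diag2_carrier], simp add: diag2_def)
  ultimately have "renyi_div \<alpha> {..<2} ?p ?q \<le> measured_renyi \<alpha> 2 ?\<rho> ?\<sigma>"
    unfolding measured_renyi_def out[symmetric] by (intro Sup_upper) blast
  \<comment> \<open>The finite bound on \<open>hyp_test_div\<close> rules out the
    \<open>-\<infinity>\<close> branch of \<open>gap\<close>.\<close>
  then have "renyi_div \<alpha> {..<2} ?p ?q - ereal (- log 2 (1 - \<epsilon> / s)) \<le> gap (measured_renyi \<alpha> 2 ?\<rho> ?\<sigma>) (hyp_test_div \<epsilon> 2 ?\<rho> ?\<sigma>)"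
    using hyp_test_div_diag2_le[OF eps] by (auto simp: gap_def intro: ereal_minus_mono)
  also have "\<dots> \<le> (SUP (\<rho>, \<sigma>) \<in> density 2 \<times> density 2. gap (measured_renyi \<alpha> 2 \<rho> \<sigma>) (hyp_test_div \<epsilon> 2 \<rho> \<sigma>))"
    using density_diag2[of s] density_diag2[of 1] eps by (intro SUP_upper2[of "(?\<rho>, ?\<sigma>)"]) auto
  also have "\<dots> \<le> nu_H \<epsilon> \<alpha>"
    unfolding nu_H_def by (rule SUP_upper) simp
  finally show ?thesis by (simp add: minus_ereal_def)
qed

section \<open>Matching of the two bounds for each range of the order\<close>

theorem theorem4:
  fixes \<epsilon> :: real and \<alpha> :: ereal
  assumes "0 < \<epsilon>" and "\<epsilon> < 1" and "0 \<le> \<alpha>"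
  shows "nu_H \<epsilon> \<alpha> =
    (if \<alpha> \<le> ereal \<epsilon> then ereal (- log 2 (1 / (1 - \<epsilon>)))
     else if \<alpha> < 1 then
       (let a = real_of_ereal \<alpha> in
         ereal (a / (1 - a) * log 2 (a / \<epsilon>) - log 2 (1 / (1 - a))))
     else \<infinity>)"
proof (cases "\<alpha> < 1")
  case False
  \<comment> \<open>The midpoint of \<open>\<epsilon>\<close> and 1: the second outcome has positive
    \<open>p\<close>-mass but \<open>q\<close>-mass zero, while the testing divergence stays
    finite.\<close>
  let ?s = "(1 + \<epsilon>) / 2"
  have s: "\<epsilon> < ?s" "?s < 1" using assms by auto
  have "1 \<in> supp {..<2} (\<lambda>x::nat. if x = 0 then ?s else 1 - ?s)" using s by (simp add: supp_def)
  moreover have "1 \<notin> supp {..<2} (\<lambda>x::nat. if x = 0 then 1 else 0)" by (simp add: supp_def)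
  ultimately have "\<not> supp {..<2} (\<lambda>x::nat. if x = 0 then ?s else 1 - ?s) \<subseteq> supp {..<2} (\<lambda>x. if x = 0 then 1 else 0)"
    by blast
  moreover have "1 < real_of_ereal \<alpha>" if "\<alpha> \<noteq> 1" "\<alpha> \<noteq> \<infinity>"
    using that False by (cases \<alpha>) (auto simp: one_ereal_def)
  ultimately have "renyi_div \<alpha> {..<2} (\<lambda>x::nat. if x = 0 then ?s else 1 - ?s) (\<lambda>x. if x = 0 then 1 else 0) = \<infinity>"
    using False by (auto simp: renyi_div_def Let_def)
  then have "nu_H \<epsilon> \<alpha> = \<infinity>" using nu_H_ge[of \<epsilon> ?s \<alpha>] assms s by simp
  moreover have "\<not> \<alpha> \<le> ereal \<epsilon>" using False assms by (cases \<alpha>) (auto simp: one_ereal_def)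
  ultimately show ?thesis using False by simp
next
  case True
  then obtain a where a: "\<alpha> = ereal a" "0 \<le> a" "a < 1"
    using assms by (cases \<alpha>) (auto simp: one_ereal_def)
  define b where "b = max a \<epsilon>"
  have b: "0 < b" "b < 1" "a \<le> b" "\<epsilon> \<le> b" using a assms by (auto simp: b_def)
  let ?\<nu> = "b / (1 - b) * log 2 (b / \<epsilon>) + log 2 (1 - b)"
  \<comment> \<open>Chosen so that \<open>1 - \<epsilon> / s = 1 - b\<close>, which supplies the
    term \<open>log 2 (1 - b)\<close>. For \<open>a \<le> \<epsilon>\<close> it gives
    \<open>s = 1\<close>, hence equal distributions and divergence zero.\<close>
  define s where "s = \<epsilon> / b"
  have s: "\<epsilon> < s" "s \<le> 1" "\<epsilon> / s = b" using assms b by (auto simp: s_def field_simps)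
  let ?p = "\<lambda>x::nat. if x = 0 then s else 1 - s" and ?q = "\<lambda>x::nat. if x = 0 then 1 else 0 :: real"
  have "renyi_div \<alpha> {..<2} ?p ?q = ereal (b / (1 - b) * log 2 (b / \<epsilon>))"
  proof (cases "a \<le> \<epsilon>")
    case True
    then have "b = \<epsilon>" "s = 1" using assms by (auto simp: b_def s_def)
    then have "supp {..<2} ?p = {0}" "supp {..<2} ?q = {0}" by (auto simp: supp_def)
    then show ?thesis using a assms \<open>b = \<epsilon>\<close>
      by (simp add: renyi_div_def neg_log2_def \<open>s = 1\<close> one_ereal_def) (simp add: numeral_2_eq_2 \<open>s = 1\<close>)
  next
    case False
    then have "b = a" by (simp add: b_def)
    have "0 \<in> supp {..<2} ?p \<inter> supp {..<2} ?q" using s assms by (simp add: supp_def)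
    then have "supp {..<2} ?p \<inter> supp {..<2} ?q \<noteq> {}" by blast
    \<comment> \<open>Only the first outcome contributes, with summand
      \<open>s powr a\<close>.\<close>
    then have "renyi_div \<alpha> {..<2} ?p ?q = ereal (1 / (a - 1) * (a * log 2 s))"
      using a False assms s by (simp add: renyi_div_def numeral_2_eq_2 one_ereal_def log_powr)
    also have "1 / (a - 1) * (a * log 2 s) = b / (1 - b) * log 2 (b / \<epsilon>)"
      using b assms unfolding s_def \<open>b = a\<close> by (simp add: log_divide field_simps)
    finally show ?thesis .
  qed
  then have "ereal ?\<nu> \<le> nu_H \<epsilon> \<alpha>" using nu_H_ge[of \<epsilon> s \<alpha>] assms s by simp
  moreover have "nu_H \<epsilon> \<alpha> \<le> ereal ?\<nu>" using nu_H_le[of \<epsilon> a b] a assms b_def by simp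
  ultimately have "nu_H \<epsilon> \<alpha> = ereal ?\<nu>" by simp
  moreover have "log 2 (1 / (1 - b)) = - log 2 (1 - b)" using b by (simp add: log_divide)
  ultimately show ?thesis using True a assms b_def by (auto simp: max_def)
qed

end
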